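(* Let $(X,d)$ be a compact metric space and $f_{0,\infty}=\{f_n\}_{n=0}^{\infty}$ an equi-continuous sequence of continuous self-maps of $X$. Then $(\mathcal K(X),\bar f_{0,\infty})$ is chain weakly mixing of all orders if and only if $(\mathcal F^1(X),\tilde f_{0,\infty})$ is chain weakly mixing of all orders.
   Context: Induced systems: $\mathcal K(X)$ is the set of nonempty compact subsets of $X$ with the Hausdorff metric $D_X$; $\bar f_{0,\infty}=\{\bar f_n\}$, $\bar f_n(A)=f_n(A)$. For upper semicontinuous $u:X\to[0,1]$ let $[u]_\alpha=\{x:u(x)\ge\alpha\}$ for $\alpha\in(0,1]$ and $[u]_0=\overline{\{x:u(x)>0\}}$. $\mathcal F^1(X)$ is the set of upper semicontinuous $u:X\to[0,1]$ with $[u]_\alpha\in\mathcal K(X)$ for all $\alpha\in[0,1]$, with metric $d_\infty(u,v)=\sup_{\alpha\in(0,1]}D_X([u]_\alpha,[v]_\alpha)$. $\tilde f_{0,\infty}=\{\tilde f_n\}$ where $\tilde f_n(u)(x)=\sup_{z\in f_n^{-1}(x)}u(z)$ if $f_n^{-1}(x)\ne\emptyset$, and $0$ otherwise. Chain notions, for a metric space $(Y,\rho)$ with a sequence of continuous self-maps $g_{0,\infty}=\{g_i\}_{i\ge0}$: a $\delta$-chain of length $m$ from $x$ to $y$ is a finite sequence $x=x_0,x_1,\dots,x_m=y$ with $\rho(g_i(x_i),x_{i+1})<\delta$ for $0\le i\le m-1$. $(Y,g_{0,\infty})$ is chain transitive if for all $x,y\in Y$ and $\epsilon>0$ there is an $\epsilon$-chain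 from $x$ to $y$. It is chain weakly mixing of all orders if for every integer $n\ge1$, $(Y^n,g_{0,\infty}^{(n)})$ is chain transitive, where $Y^n$ carries the max product metric and $g_{0,\infty}^{(n)}=\{g_i\times\cdots\times g_i\}_{i\ge0}$ ($n$ factors). *)

theory Defs
  imports "HOL-Analysis.Analysis"
begin

section \<open>Chains in nonautonomous systems\<close>

text \<open>
  A metric space is given by a carrier \<open>Y\<close> and a distance function \<open>\<rho>\<close>; a system on it is a sequence
  \<open>g\<close> of maps, of which only the values on \<open>Y\<close> matter.
  A \<open>\<delta>\<close>-chain of length \<open>m\<close> is a function on indices, of which only the values at \<open>0, \<dots>, m\<close> matter.
  The map applied at step \<open>i\<close> is \<open>g i\<close>: every chain starts at time \<open>0\<close>.
\<close>

definition is_chain ::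
    "'b set \<Rightarrow> ('b \<Rightarrow> 'b \<Rightarrow> real) \<Rightarrow> (nat \<Rightarrow> 'b \<Rightarrow> 'b) \<Rightarrow> real \<Rightarrow> nat \<Rightarrow> 'b \<Rightarrow> 'b \<Rightarrow> (nat \<Rightarrow> 'b) \<Rightarrow> bool"
  where
  "is_chain Y \<rho> g \<delta> m x y c \<longleftrightarrow>
     c 0 = x \<and> c m = y \<and> (\<forall>i\<le>m. c i \<in> Y) \<and> (\<forall>i<m. \<rho> (g i (c i)) (c (Suc i)) < \<delta>)"

text \<open>Chains have positive length; otherwise a point would be trivially chained to itself.\<close>

definition chain_transitive ::
    "'b set \<Rightarrow> ('b \<Rightarrow> 'b \<Rightarrow> real) \<Rightarrow> (nat \<Rightarrow> 'b \<Rightarrow> 'b) \<Rightarrow> bool"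
  where
  "chain_transitive Y \<rho> g \<longleftrightarrow>
     (\<forall>x\<in>Y. \<forall>y\<in>Y. \<forall>\<epsilon>>0. \<exists>m\<ge>1. \<exists>c. is_chain Y \<rho> g \<epsilon> m x y c)"

text \<open>\<open>Y\<^sup>n\<close> is represented by the functions \<open>{..<n} \<rightarrow>\<^sub>E Y\<close>, extensional outside \<open>{..<n}\<close>.\<close>

definition power_space :: "nat \<Rightarrow> 'b set \<Rightarrow> (nat \<Rightarrow> 'b) set"
  where "power_space n Y = {..<n} \<rightarrow>\<^sub>E Y"

definition power_dist ::
    "nat \<Rightarrow> ('b \<Rightarrow> 'b \<Rightarrow> real) \<Rightarrow> (nat \<Rightarrow> 'b) \<Rightarrow> (nat \<Rightarrow> 'b) \<Rightarrow> real"
  where "power_dist n \<rho> x y = Max ((\<lambda>j. \<rho> (x j) (y j)) ` {..<n})"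

definition power_system ::
    "nat \<Rightarrow> (nat \<Rightarrow> 'b \<Rightarrow> 'b) \<Rightarrow> nat \<Rightarrow> (nat \<Rightarrow> 'b) \<Rightarrow> (nat \<Rightarrow> 'b)"
  where "power_system n g i x = (\<lambda>j\<in>{..<n}. g i (x j))"

definition chain_weakly_mixing_all_orders ::
    "'b set \<Rightarrow> ('b \<Rightarrow> 'b \<Rightarrow> real) \<Rightarrow> (nat \<Rightarrow> 'b \<Rightarrow> 'b) \<Rightarrow> bool"
  where
  "chain_weakly_mixing_all_orders Y \<rho> g \<longleftrightarrow>
     (\<forall>n\<ge>1. chain_transitive (power_space n Y) (power_dist n \<rho>) (power_system n g))"


section \<open>Equi-continuous sequences\<close>

definition equi_continuous :: "(nat \<Rightarrow> 'a::metric_space \<Rightarrow> 'a) \<Rightarrow> bool"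
  where
  "equi_continuous f \<longleftrightarrow>
     (\<forall>\<epsilon>>0. \<exists>\<delta>>0. \<forall>n x y. dist x y < \<delta> \<longrightarrow> dist (f n x) (f n y) < \<epsilon>)"


section \<open>The hyperspace of nonempty compact sets\<close>

definition hyper :: "'a::metric_space set set"
  where "hyper = {A. compact A \<and> A \<noteq> {}}"

text \<open>
  \<open>infdist a B\<close> is the infimum of \<open>dist a b\<close> over \<open>b \<in> B\<close>. The formula is the Hausdorff metric on
  \<open>hyper\<close>; it is not meant to be used elsewhere.
\<close>

definition hausdorff_dist :: "'a::metric_space set \<Rightarrow> 'a set \<Rightarrow> real"
  where "hausdorff_dist A B = max (SUP a\<in>A. infdist a B) (SUP b\<in>B. infdist b A)"

definition hyper_system :: "(nat \<Rightarrow> 'a \<Rightarrow> 'a) \<Rightarrow> nat \<Rightarrow> 'a set \<Rightarrow> 'a set"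
  where "hyper_system f n A = f n ` A"


section \<open>The space of normal fuzzy sets\<close>

definition level_set :: "('a::metric_space \<Rightarrow> real) \<Rightarrow> real \<Rightarrow> 'a set"
  where "level_set u \<alpha> = (if \<alpha> = 0 then closure {x. u x > 0} else {x. u x \<ge> \<alpha>})"

definition upper_semicontinuous :: "('a::metric_space \<Rightarrow> real) \<Rightarrow> bool"
  where "upper_semicontinuous u \<longleftrightarrow> (\<forall>c. open {x. u x < c})"

definition fuzzy :: "('a::metric_space \<Rightarrow> real) set"
  where
  "fuzzy = {u. range u \<subseteq> {0..1} \<and> upper_semicontinuous u \<and> (\<forall>\<alpha>\<in>{0..1}. level_set u \<alpha> \<in> hyper)}"

definition fuzzy_dist :: "('a::metric_space \<Rightarrow> real) \<Rightarrow> ('a \<Rightarrow> real) \<Rightarrow> real"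
  where "fuzzy_dist u v = (SUP \<alpha>\<in>{0<..1}. hausdorff_dist (level_set u \<alpha>) (level_set v \<alpha>))"

definition fuzzy_system :: "(nat \<Rightarrow> 'a \<Rightarrow> 'a) \<Rightarrow> nat \<Rightarrow> ('a \<Rightarrow> real) \<Rightarrow> ('a \<Rightarrow> real)"
  where
  "fuzzy_system f n u x = (if f n -` {x} \<noteq> {} then SUP z\<in>f n -` {x}. u z else 0)"

end

theory Submission
  imports Defs
begin

text \<open>
  The level set at height \<open>1\<close> of a chain of fuzzy sets is a chain of compact sets, and indicator
  functions embed compact sets as fuzzy sets; this gives one direction.

  Conversely, by compactness finitely many levels \<open>L\<close> suffice to approximate all level sets of
  finitely many given fuzzy sets. Chain the level sets at the levels in \<open>L\<close> simultaneously, using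
  mixing of a high enough order. The resulting families need not be nested at intermediate times, but
  replacing the set at level \<open>\<alpha>\<close> by the union over all levels \<open>l \<ge> \<alpha>\<close> in \<open>L\<close> makes them so, and
  unions do not increase the Hausdorff distance. The step functions with these level sets form the
  chain, and equi-continuity absorbs the approximation error at its two ends.
\<close>

section \<open>Simultaneous chains\<close>

lemma power_dist_less_iff:
  assumes "n \<ge> 1"
  shows "power_dist n \<rho> x y < e \<longleftrightarrow> (\<forall>j<n. \<rho> (x j) (y j) < e)"
proof -
  have "{..<n} \<noteq> {}" using assms by (auto simp: lessThan_empty_iff)
  then show ?thesis unfolding power_dist_def by auto
qed

text \<open>The maximum metric is below \<open>e\<close> exactly when every coordinate is, so a
  chain in the power space amounts to \<open>n\<close> chains of one common length \<open>m\<close>.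
  Restriction to \<open>{..<n}\<close> discards the values that \<open>x\<close> and
  \<open>y\<close> take at other indices.\<close>

lemma chain_weakly_mixing_iff:
  "chain_weakly_mixing_all_orders Y \<rho> g \<longleftrightarrow>
     (\<forall>n::nat. n \<ge> 1 \<longrightarrow> (\<forall>x y. (\<forall>j<n. x j \<in> Y \<and> y j \<in> Y) \<longrightarrow>
       (\<forall>e>0. \<exists>m\<ge>1. \<exists>c. \<forall>j<n. is_chain Y \<rho> g e m (x j) (y j) (c j))))"
  (is "_ \<longleftrightarrow> ?R")
proof
  assume M: "chain_weakly_mixing_all_orders Y \<rho> g"
  show ?R
  proof (intro allI impI)
    fix n :: nat and x y :: "nat \<Rightarrow> 'a" and e :: real
    assume n: "1 \<le> n" and xy: "\<forall>j<n. x j \<in> Y \<and> y j \<in> Y" and e: "e > 0"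
    have "restrict x {..<n} \<in> power_space n Y" "restrict y {..<n} \<in> power_space n Y"
      using xy by (auto simp: power_space_def)
    then obtain m c where m: "m \<ge> 1"
      and c: "is_chain (power_space n Y) (power_dist n \<rho>) (power_system n g) e m
                (restrict x {..<n}) (restrict y {..<n}) c"
      using M n e unfolding chain_weakly_mixing_all_orders_def chain_transitive_def by blast
    have "is_chain Y \<rho> g e m (x j) (y j) (\<lambda>t. c t j)" if "j < n" for j
      using c that unfolding is_chain_def power_dist_less_iff[OF n]
      by (auto simp: power_space_def power_system_def PiE_iff)
    with m show "\<exists>m\<ge>1. \<exists>c. \<forall>j<n. is_chain Y \<rho> g e m (x j) (y j) (c j)"
      by (intro exI[of _ m] conjI exI[of _ "\<lambda>j t. c t j"]) auto
  qed
next
  assume R: ?R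
  show "chain_weakly_mixing_all_orders Y \<rho> g"
    unfolding chain_weakly_mixing_all_orders_def chain_transitive_def
  proof (intro allI impI ballI)
    fix n :: nat and x y and e :: real
    assume n: "1 \<le> n" and x: "x \<in> power_space n Y" and y: "y \<in> power_space n Y" and e: "e > 0"
    have "\<forall>j<n. x j \<in> Y \<and> y j \<in> Y"
      using x y by (auto simp: power_space_def)
    then obtain m c where m: "m \<ge> 1" and c: "\<forall>j<n. is_chain Y \<rho> g e m (x j) (y j) (c j)"
      using R[rule_format, of n x y e] n e by auto
    let ?c = "\<lambda>t. \<lambda>j\<in>{..<n}. c j t"
    have "?c 0 = x"
      using c x by (intro PiE_ext[where k = "{..<n}" and s = "\<lambda>_. Y"])
        (auto simp: power_space_def is_chain_def)
    moreover have "?c m = y"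
      using c y by (intro PiE_ext[where k = "{..<n}" and s = "\<lambda>_. Y"])
        (auto simp: power_space_def is_chain_def)
    ultimately have "is_chain (power_space n Y) (power_dist n \<rho>) (power_system n g) e m x y ?c"
      using c unfolding is_chain_def power_dist_less_iff[OF n]
      by (auto simp: power_space_def power_system_def)
    with m show "\<exists>m\<ge>1. \<exists>c. is_chain (power_space n Y) (power_dist n \<rho>) (power_system n g) e m x y c"
      by blast
  qed
qed

text \<open>Reindexing along a bijection from \<open>{..<card J}\<close>. It will be applied to
  pairs of a coordinate and a level.\<close>

lemma chain_weakly_mixing_finite:
  assumes "chain_weakly_mixing_all_orders Y \<rho> g" and "finite J" "J \<noteq> {}"
    and "\<And>j. j \<in> J \<Longrightarrow> x j \<in> Y" "\<And>j. j \<in> J \<Longrightarrow> y j \<in> Y" and "e > 0"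
  obtains m c where "m \<ge> 1" "\<And>j. j \<in> J \<Longrightarrow> is_chain Y \<rho> g e m (x j) (y j) (c j)"
proof -
  obtain h where h: "bij_betw h {..<card J} J"
    using \<open>finite J\<close> bij_betw_from_nat_into_finite by blast
  have "card J \<ge> 1"
    using assms(2,3) by (simp add: Suc_le_eq card_gt_0_iff)
  moreover have "\<forall>i<card J. x (h i) \<in> Y \<and> y (h i) \<in> Y"
    using h assms(4,5) bij_betwE by blast
  ultimately obtain m c where m: "m \<ge> 1"
    and c: "\<forall>i<card J. is_chain Y \<rho> g e m (x (h i)) (y (h i)) (c i)"
    using assms(1)[unfolded chain_weakly_mixing_iff, rule_format,
        of "card J" "\<lambda>i. x (h i)" "\<lambda>i. y (h i)" e] \<open>e > 0\<close> by auto
  show thesis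
  proof (rule that[OF m, of "\<lambda>j. c (the_inv_into {..<card J} h j)"])
    fix j assume "j \<in> J"
    then have "the_inv_into {..<card J} h j < card J" "h (the_inv_into {..<card J} h j) = j"
      using h the_inv_into_into[of h "{..<card J}" j] f_the_inv_into_f[of h "{..<card J}" j]
      by (auto simp: bij_betw_def)
    with c show "is_chain Y \<rho> g e m (x j) (y j) (c (the_inv_into {..<card J} h j))"
      by metis
  qed
qed


section \<open>Hausdorff distance\<close>

text \<open>Non-strict Hausdorff closeness by explicit witnesses. Unlike the formula with suprema
  and infima it is meaningful for arbitrary sets, and unions and images can be treated
  pointwise.\<close>

definition hausdorff_close :: "real \<Rightarrow> 'a::metric_space set \<Rightarrow> 'a set \<Rightarrow> bool"
  where "hausdorff_close e A B \<longleftrightarrow>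
    (\<forall>a\<in>A. \<exists>b\<in>B. dist a b \<le> e) \<and> (\<forall>b\<in>B. \<exists>a\<in>A. dist a b \<le> e)"

text \<open>The infimum over a nonempty compact set is attained, so a witness exists even for the
  non-strict bound.\<close>

lemma infdist_le_iff_compact:
  assumes "compact B" "B \<noteq> {}"
  shows "infdist a B \<le> e \<longleftrightarrow> (\<exists>b\<in>B. dist a b \<le> e)"
proof
  assume "infdist a B \<le> e"
  moreover obtain b where "b \<in> B" and b: "\<And>y. y \<in> B \<Longrightarrow> dist a b \<le> dist a y"
    using continuous_attains_inf[OF assms, of "dist a"]
      continuous_on_dist[OF continuous_on_const continuous_on_id, of B a] by auto
  then have "dist a b \<le> infdist a B"
    using assms(2) by (simp add: infdist_notempty cINF_greatest)
  ultimately show "\<exists>b\<in>B. dist a b \<le> e" using \<open>b \<in> B\<close> by force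
next
  assume "\<exists>b\<in>B. dist a b \<le> e"
  then show "infdist a B \<le> e" using infdist_le2 by blast
qed

text \<open>The continuous function \<open>infdist\<close> is bounded on the compact set
  \<open>A\<close>, so the supremum is at most \<open>e\<close> iff each value is.\<close>

lemma SUP_infdist_le_iff:
  assumes "A \<in> hyper" "B \<in> hyper"
  shows "(SUP a\<in>A. infdist a B) \<le> e \<longleftrightarrow> (\<forall>a\<in>A. \<exists>b\<in>B. dist a b \<le> e)"
proof -
  have "compact ((\<lambda>a. infdist a B) ` A)"
    using assms by (intro compact_continuous_image continuous_intros) (auto simp: hyper_def)
  then have "bdd_above ((\<lambda>a. infdist a B) ` A)"
    by (simp add: bounded_imp_bdd_above compact_imp_bounded)
  then show ?thesis
    using assms by (simp add: hyper_def cSUP_le_iff infdist_le_iff_compact)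
qed

lemma hausdorff_dist_le_iff:
  assumes "A \<in> hyper" "B \<in> hyper"
  shows "hausdorff_dist A B \<le> e \<longleftrightarrow> hausdorff_close e A B"
  using SUP_infdist_le_iff[OF assms] SUP_infdist_le_iff[OF assms(2,1)]
  by (simp add: hausdorff_dist_def hausdorff_close_def dist_commute)

lemma hausdorff_close_refl: "e \<ge> 0 \<Longrightarrow> hausdorff_close e A A"
  unfolding hausdorff_close_def by force

lemma hausdorff_close_sym: "hausdorff_close e A B \<Longrightarrow> hausdorff_close e B A"
  unfolding hausdorff_close_def by (simp add: dist_commute)

lemma hausdorff_close_trans:
  assumes "hausdorff_close d A B" "hausdorff_close e B C"
  shows "hausdorff_close (d + e) A C"
proof -
  have "dist a c \<le> d + e" if "dist a b \<le> d" "dist b c \<le> e" for a b c :: 'a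
    using that dist_triangle[of a c b] by linarith
  with assms show ?thesis unfolding hausdorff_close_def by meson
qed

text \<open>A partner for a point of \<open>A i\<close> is found in \<open>B i\<close> with the same
  index, so the bound is not worsened.\<close>

lemma hausdorff_close_UN:
  assumes "\<And>i. i \<in> I \<Longrightarrow> hausdorff_close e (A i) (B i)"
  shows "hausdorff_close e (\<Union>i\<in>I. A i) (\<Union>i\<in>I. B i)"
  using assms unfolding hausdorff_close_def by fast

lemma hausdorff_close_image:
  assumes "hausdorff_close d A B" and "\<And>x y. dist x y \<le> d \<Longrightarrow> dist (h x) (h y) \<le> e"
  shows "hausdorff_close e (h ` A) (h ` B)"
  using assms unfolding hausdorff_close_def by fast


section \<open>Level sets of fuzzy sets\<close>

text \<open>Without a maximum the open sets \<open>{y. u y < u x}\<close> with \<open>x\<close> in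
  \<open>K\<close> would cover \<open>K\<close>. In a finite subcover the centre of largest value
  lies in none of them.\<close>

lemma upper_semicontinuous_attains_max:
  assumes u: "upper_semicontinuous u" and K: "compact K" "K \<noteq> {}"
  shows "\<exists>z\<in>K. \<forall>x\<in>K. u x \<le> u z"
proof (rule ccontr)
  assume "\<not> ?thesis"
  then have no_max: "\<forall>z\<in>K. \<exists>x\<in>K. u z < u x"
    by (meson not_le)
  have "open {y. u y < u x}" for x
    using u by (auto simp: upper_semicontinuous_def)
  moreover have "K \<subseteq> (\<Union>x\<in>K. {y. u y < u x})"
    using no_max by blast
  ultimately obtain C where C: "C \<subseteq> K" "finite C" "K \<subseteq> (\<Union>x\<in>C. {y. u y < u x})"
    using compactE_image[OF K(1)] by metis
  then have "C \<noteq> {}" using K(2) by blast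
  then have "Max (u ` C) \<in> u ` C" using C(2) by simp
  then obtain z where z: "z \<in> C" "u z = Max (u ` C)" by auto
  then obtain x where "x \<in> C" "u z < u x" using C(1,3) by blast
  then have "u x \<le> u z" unfolding z(2) using C(2) by (intro Max_ge) auto
  with \<open>u z < u x\<close> show False by simp
qed

lemma level_set_pos: "\<alpha> > 0 \<Longrightarrow> level_set u \<alpha> = {x. u x \<ge> \<alpha>}"
  by (simp add: level_set_def)

lemma fuzzy_level_in_hyper: "u \<in> fuzzy \<Longrightarrow> \<alpha> \<in> {0<..1} \<Longrightarrow> level_set u \<alpha> \<in> hyper"
  by (simp add: fuzzy_def)

text \<open>Closed subsets of a compact space are compact, and a point of value \<open>1\<close>
  lies in every level set, so none is empty.\<close>

lemma fuzzyI:
  fixes u :: "'a::metric_space \<Rightarrow> real"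
  assumes X: "compact (UNIV :: 'a set)" and r: "range u \<subseteq> {0..1}"
    and cl: "\<And>\<alpha>. \<alpha> \<in> {0<..1} \<Longrightarrow> closed {x. u x \<ge> \<alpha>}" and one: "u x = 1"
  shows "u \<in> fuzzy"
proof -
  have bd: "0 \<le> u y" "u y \<le> 1" for y using r by (auto simp: image_subset_iff)
  have "open {y. u y < c}" for c
  proof (cases "c \<in> {0<..1}")
    case True
    have "{y. u y < c} = - {y. u y \<ge> c}" by auto
    with cl[OF True] show ?thesis by auto
  next
    \<comment> \<open>For \<open>c\<close> \<le> 0 no point qualifies, for \<open>c\<close> > 1 all
      points do.\<close>
    case False
    then have "{y. u y < c} = {} \<or> {y. u y < c} = UNIV"
      using bd by (smt (verit) Collect_empty_eq UNIV_eq_I greaterThanAtMost_iff mem_Collect_eq)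
    then show ?thesis by auto
  qed
  moreover have "level_set u \<alpha> \<in> hyper" if "\<alpha> \<in> {0..1}" for \<alpha>
  proof -
    have "closed (level_set u \<alpha>)"
      using cl that by (auto simp: level_set_def)
    moreover have "x \<in> level_set u \<alpha>"
      using that one closure_subset[of "{x. u x > 0}"] by (auto simp: level_set_def)
    ultimately show ?thesis
      using compact_Int_closed[OF X] by (auto simp: hyper_def)
  qed
  ultimately show ?thesis
    using r by (auto simp: fuzzy_def upper_semicontinuous_def)
qed

text \<open>Fibres of \<open>f n\<close> are compact, so the supremum over a nonempty fibre is
  attained and reaches \<alpha> iff some point of the fibre does. On an empty fibre the default
  value 0 stays below \<alpha> > 0.\<close>

lemma level_set_fuzzy_system:
  fixes f :: "nat \<Rightarrow> 'a::metric_space \<Rightarrow> 'a"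
  assumes X: "compact (UNIV :: 'a set)" and f: "continuous_on UNIV (f n)"
    and u: "u \<in> fuzzy" and \<alpha>: "\<alpha> > 0"
  shows "level_set (fuzzy_system f n u) \<alpha> = f n ` level_set u \<alpha>"
proof -
  have "fuzzy_system f n u x \<ge> \<alpha> \<longleftrightarrow> (\<exists>z\<in>f n -` {x}. u z \<ge> \<alpha>)" for x
  proof (cases "f n -` {x} = {}")
    case True
    then show ?thesis using \<alpha> by (simp add: fuzzy_system_def)
  next
    case False
    have "closed (f n -` {x})"
      using f by (simp add: continuous_closed_vimage continuous_on_eq_continuous_at)
    then have "compact (f n -` {x})"
      using compact_Int_closed[OF X] by auto
    moreover have "upper_semicontinuous u" using u by (simp add: fuzzy_def)
    ultimately obtain z where z: "z \<in> f n -` {x}" "\<And>y. y \<in> f n -` {x} \<Longrightarrow> u y \<le> u z"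
      using upper_semicontinuous_attains_max[OF _ _ False, of u] by blast
    then have "(SUP y\<in>f n -` {x}. u y) = u z"
      by (intro cSup_eq_maximum) auto
    then have "fuzzy_system f n u x = u z"
      using False by (simp add: fuzzy_system_def)
    then show ?thesis using z by force
  qed
  then show ?thesis using \<alpha> by (auto simp: level_set_pos image_iff)
qed

lemma fuzzy_dist_le:
  assumes "\<And>\<alpha>. \<alpha> \<in> {0<..1} \<Longrightarrow> level_set u \<alpha> \<in> hyper" "\<And>\<alpha>. \<alpha> \<in> {0<..1} \<Longrightarrow> level_set v \<alpha> \<in> hyper"
    and "\<And>\<alpha>. \<alpha> \<in> {0<..1} \<Longrightarrow> hausdorff_close e (level_set u \<alpha>) (level_set v \<alpha>)"
  shows "fuzzy_dist u v \<le> e"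
  unfolding fuzzy_dist_def using assms by (intro cSUP_least) (auto simp: hausdorff_dist_le_iff)

text \<open>Compactness bounds all distances in the space, hence the family of Hausdorff distances
  whose supremum is taken. The assumptions concern level sets rather than membership in
  \<open>fuzzy\<close> so that they can be checked for \<open>fuzzy_system f n u\<close> through
  \<open>level_set_fuzzy_system\<close>.\<close>

lemma hausdorff_dist_le_fuzzy_dist:
  fixes u v :: "'a::metric_space \<Rightarrow> real"
  assumes X: "compact (UNIV :: 'a set)"
    and u: "\<And>\<alpha>. \<alpha> \<in> {0<..1} \<Longrightarrow> level_set u \<alpha> \<in> hyper"
    and v: "\<And>\<alpha>. \<alpha> \<in> {0<..1} \<Longrightarrow> level_set v \<alpha> \<in> hyper"
    and \<alpha>: "\<alpha> \<in> {0<..1}"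
  shows "hausdorff_dist (level_set u \<alpha>) (level_set v \<alpha>) \<le> fuzzy_dist u v"
proof -
  have "bounded (UNIV :: 'a set)" using X by (rule compact_imp_bounded)
  then obtain M where M: "dist x y \<le> M" for x y :: 'a
    using bounded_two_points by (metis UNIV_I)
  have "hausdorff_dist (level_set u \<beta>) (level_set v \<beta>) \<le> M" if "\<beta> \<in> {0<..1}" for \<beta>
    using u[OF that] v[OF that] M
    unfolding hausdorff_dist_le_iff[OF u[OF that] v[OF that]] hausdorff_close_def
    by (auto simp: hyper_def)
  then show ?thesis
    unfolding fuzzy_dist_def by (intro cSUP_upper[OF \<alpha>] bdd_aboveI2)
qed


section \<open>Step functions\<close>

text \<open>The value is the highest level whose set contains \<open>x\<close>, or 0 if there is
  none. The family \<open>A\<close> may fail to be nested.\<close>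

definition step_fun :: "real set \<Rightarrow> (real \<Rightarrow> 'a set) \<Rightarrow> 'a \<Rightarrow> real"
  where "step_fun L A x = Max (insert 0 {l\<in>L. x \<in> A l})"

lemma level_set_step_fun:
  assumes "finite L" and "\<alpha> > 0"
  shows "level_set (step_fun L A) \<alpha> = (\<Union>l\<in>{l\<in>L. \<alpha> \<le> l}. A l)"
  using assms by (auto simp: level_set_pos step_fun_def Max_ge_iff)

text \<open>Level sets are finite unions of compact sets, hence closed. The level \<open>1\<close>
  with its nonempty set \<open>A 1\<close> provides a point of value \<open>1\<close>.\<close>

lemma step_fun_fuzzy:
  fixes A :: "real \<Rightarrow> 'a::metric_space set"
  assumes X: "compact (UNIV :: 'a set)" and L: "finite L" "L \<subseteq> {0<..1}" "1 \<in> L"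
    and A: "\<And>l. l \<in> L \<Longrightarrow> A l \<in> hyper"
  shows "step_fun L A \<in> fuzzy"
proof -
  have r: "step_fun L A x \<in> {0..1}" for x
    using L by (auto simp: step_fun_def Max_ge_iff)
  obtain x where x: "x \<in> A 1" using A L(3) by (auto simp: hyper_def)
  have "step_fun L A x \<ge> 1"
    using L x by (auto simp: step_fun_def Max_ge_iff)
  then have "step_fun L A x = 1" using r[of x] by simp
  moreover have "closed {x. step_fun L A x \<ge> \<alpha>}" if "\<alpha> \<in> {0<..1}" for \<alpha>
  proof -
    have "closed (\<Union>l\<in>{l\<in>L. \<alpha> \<le> l}. A l)"
      using L A by (intro closed_UN) (auto simp: hyper_def compact_imp_closed)
    then show ?thesis
      using that level_set_step_fun[OF L(1), of \<alpha> A] by (simp add: level_set_pos)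
  qed
  ultimately show ?thesis using r by (intro fuzzyI[OF X]) auto
qed

text \<open>
  The levels are the maxima of \<open>u\<close> over the balls of a finite cover: a point of height at least \<open>\<alpha>\<close>
  is moved to the maximum point of a ball containing it.
\<close>

lemma fuzzy_finite_levels:
  fixes u :: "'a::metric_space \<Rightarrow> real"
  assumes X: "compact (UNIV :: 'a set)" and u: "u \<in> fuzzy" and d: "d > 0"
  shows "\<exists>L. finite L \<and> L \<subseteq> {0<..1} \<and>
    (\<forall>a. u a > 0 \<longrightarrow> (\<exists>b. u b \<in> L \<and> u a \<le> u b \<and> dist a b \<le> d))"
proof -
  obtain F where F: "finite F" "(UNIV :: 'a set) \<subseteq> (\<Union>p\<in>F. ball p (d/2))"
  proof (rule compactE_image[OF X, of UNIV "\<lambda>p. ball p (d/2)"])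
    show "(UNIV :: 'a set) \<subseteq> (\<Union>p\<in>UNIV. ball p (d/2))"
      using d by (auto intro: centre_in_ball[THEN iffD2])
  qed auto
  have "\<exists>z\<in>cball p (d/2). \<forall>x\<in>cball p (d/2). u x \<le> u z" for p
  proof -
    have "compact (cball p (d/2))" using compact_Int_closed[OF X] by auto
    moreover have "cball p (d/2) \<noteq> {}" using d by simp
    moreover have "upper_semicontinuous u" using u by (simp add: fuzzy_def)
    ultimately show ?thesis
      by (intro upper_semicontinuous_attains_max)
  qed
  then obtain z where z: "z p \<in> cball p (d/2)"
      "\<forall>x\<in>cball p (d/2). u x \<le> u (z p)" for p
    by metis
  have r: "u x \<le> 1" for x using u by (auto simp: fuzzy_def image_subset_iff)
  \<comment> \<open>Intersecting with \<open>{0<..1}\<close> drops the balls on which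
    \<open>u\<close> vanishes; the ball containing \<open>a\<close> is kept because
    \<open>u a > 0\<close>.\<close>
  have "\<exists>b. u b \<in> (\<lambda>p. u (z p)) ` F \<inter> {0<..1} \<and> u a \<le> u b \<and> dist a b \<le> d"
    if "u a > 0" for a
  proof -
    have "a \<in> (\<Union>p\<in>F. ball p (d/2))" using F(2) by blast
    then obtain p where p: "p \<in> F" "dist p a < d/2" by auto
    then have le: "u a \<le> u (z p)" using z(2)[of p] by simp
    have "dist p (z p) \<le> d/2" using z(1)[of p] by simp
    then have "dist a (z p) \<le> d"
      using p(2) dist_triangle3[of a "z p" p] by linarith
    moreover have "u (z p) \<in> (\<lambda>p. u (z p)) ` F \<inter> {0<..1}"
      using p(1) le that r[of "z p"] by simp
    ultimately show ?thesis using le by blast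
  qed
  with F(1) show ?thesis
    by (intro exI[of _ "(\<lambda>p. u (z p)) ` F \<inter> {0<..1}"]) auto
qed

text \<open>The levels found for the single members of \<open>U\<close> are pooled. Extra levels do
  no harm: for \<open>l\<close> \<ge> \<alpha> the level set at \<open>l\<close> is contained in the
  one at \<alpha>.\<close>

lemma fuzzy_finite_common_levels:
  fixes U :: "('a::metric_space \<Rightarrow> real) set"
  assumes X: "compact (UNIV :: 'a set)" and U: "finite U" "U \<subseteq> fuzzy" and d: "d > 0"
  obtains L where "finite L" "L \<subseteq> {0<..1}" "1 \<in> L"
    "\<And>u \<alpha>. u \<in> U \<Longrightarrow> \<alpha> > 0 \<Longrightarrow>
       hausdorff_close d (level_set u \<alpha>) (\<Union>l\<in>{l\<in>L. \<alpha> \<le> l}. level_set u l)"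
proof -
  have "\<forall>u\<in>U. \<exists>L. finite L \<and> L \<subseteq> {0<..1} \<and>
      (\<forall>a. u a > 0 \<longrightarrow> (\<exists>b. u b \<in> L \<and> u a \<le> u b \<and> dist a b \<le> d))"
    using fuzzy_finite_levels[OF X _ d] U(2) by blast
  then obtain K where K: "\<And>u. u \<in> U \<Longrightarrow> finite (K u)" "\<And>u. u \<in> U \<Longrightarrow> K u \<subseteq> {0<..1}"
      "\<And>u a. u \<in> U \<Longrightarrow> u a > 0 \<Longrightarrow> \<exists>b. u b \<in> K u \<and> u a \<le> u b \<and> dist a b \<le> d"
    by metis
  \<comment> \<open>Level \<open>1\<close> is added because \<open>step_fun_fuzzy\<close> requires
    it.\<close>
  define L where "L = insert 1 (\<Union>u\<in>U. K u)"
  have close: "hausdorff_close d (level_set u \<alpha>) (\<Union>l\<in>{l\<in>L. \<alpha> \<le> l}. level_set u l)"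
    if u: "u \<in> U" and \<alpha>: "\<alpha> > 0" for u \<alpha>
    unfolding hausdorff_close_def
  proof (intro conjI ballI)
    fix a assume "a \<in> level_set u \<alpha>"
    then have a: "\<alpha> \<le> u a" using \<alpha> by (simp add: level_set_pos)
    then obtain b where b: "u b \<in> K u" "u a \<le> u b" "dist a b \<le> d"
      using K(3)[OF u, of a] \<alpha> by auto
    have "b \<in> level_set u (u b)" using \<alpha> a b(2) by (simp add: level_set_pos)
    moreover have "u b \<in> {l\<in>L. \<alpha> \<le> l}" using u a b by (auto simp: L_def)
    ultimately show "\<exists>b\<in>\<Union>l\<in>{l\<in>L. \<alpha> \<le> l}. level_set u l. dist a b \<le> d"
      using b(3) by blast
  next
    fix b assume "b \<in> (\<Union>l\<in>{l\<in>L. \<alpha> \<le> l}. level_set u l)"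
    then have "b \<in> level_set u \<alpha>" using \<alpha> by (auto simp: level_set_pos)
    then show "\<exists>a\<in>level_set u \<alpha>. dist a b \<le> d" using d by (intro bexI[of _ b]) auto
  qed
  show thesis
    by (rule that[OF _ _ _ close]) (use U K(1,2) in \<open>auto simp: L_def\<close>)
qed


section \<open>Transfer of chains\<close>

lemma fuzzy_mixing_imp_hyper_mixing:
  fixes f :: "nat \<Rightarrow> 'a::metric_space \<Rightarrow> 'a"
  assumes X: "compact (UNIV :: 'a set)" and f: "\<And>n. continuous_on UNIV (f n)"
    and mix: "chain_weakly_mixing_all_orders (fuzzy :: ('a \<Rightarrow> real) set) fuzzy_dist (fuzzy_system f)"
  shows "chain_weakly_mixing_all_orders (hyper :: 'a set set) hausdorff_dist (hyper_system f)"
  unfolding chain_weakly_mixing_iff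
proof (intro allI impI)
  fix n :: nat and A B :: "nat \<Rightarrow> 'a set" and e :: real
  assume n: "1 \<le> n" and AB: "\<forall>j<n. A j \<in> hyper \<and> B j \<in> hyper" and e: "0 < e"
  \<comment> \<open>The indicator function of \<open>C\<close>.\<close>
  let ?s = "\<lambda>C. step_fun {1} (\<lambda>_. C)"
  have s: "?s C \<in> fuzzy" "level_set (?s C) 1 = C" if "C \<in> hyper" for C :: "'a set"
    using that by (simp_all add: step_fun_fuzzy[OF X] level_set_step_fun Collect_conv_if)
  obtain m c where m: "m \<ge> 1"
    and c: "\<forall>j<n. is_chain fuzzy fuzzy_dist (fuzzy_system f) e m (?s (A j)) (?s (B j)) (c j)"
    using mix[unfolded chain_weakly_mixing_iff, rule_format,
        of n "\<lambda>j. ?s (A j)" "\<lambda>j. ?s (B j)" e] n AB e s by auto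
  have "is_chain hyper hausdorff_dist (hyper_system f) e m (A j) (B j) (\<lambda>t. level_set (c j t) 1)"
    if j: "j < n" for j
    unfolding is_chain_def
  proof (intro conjI allI impI)
    have cj: "is_chain fuzzy fuzzy_dist (fuzzy_system f) e m (?s (A j)) (?s (B j)) (c j)"
      using c j by blast
    show "level_set (c j 0) 1 = A j" "level_set (c j m) 1 = B j"
      using cj s AB j by (auto simp: is_chain_def)
    have fz: "c j t \<in> fuzzy" if "t \<le> m" for t
      using cj that by (auto simp: is_chain_def)
    show "level_set (c j t) 1 \<in> hyper" if "t \<le> m" for t
      using fuzzy_level_in_hyper[OF fz[OF that]] by simp
    fix t assume t: "t < m"
    have lev: "level_set (fuzzy_system f t (c j t)) \<alpha> = f t ` level_set (c j t) \<alpha>"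
      if "\<alpha> \<in> {0<..1}" for \<alpha>
      using level_set_fuzzy_system[of f t "c j t" \<alpha>] X f fz t that by simp
    have "level_set (fuzzy_system f t (c j t)) \<alpha> \<in> hyper" if "\<alpha> \<in> {0<..1}" for \<alpha>
      using lev[OF that] fuzzy_level_in_hyper[OF fz that, of t] t
      by (auto simp: hyper_def intro!: compact_continuous_image continuous_on_subset[OF f])
    then have "hausdorff_dist (level_set (fuzzy_system f t (c j t)) 1) (level_set (c j (Suc t)) 1)
        \<le> fuzzy_dist (fuzzy_system f t (c j t)) (c j (Suc t))"
      using fuzzy_level_in_hyper[OF fz] t by (intro hausdorff_dist_le_fuzzy_dist[OF X]) auto
    also have "\<dots> < e" using cj t by (auto simp: is_chain_def)
    finally show "hausdorff_dist (hyper_system f t (level_set (c j t) 1)) (level_set (c j (Suc t)) 1) < e"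
      using lev[of 1] by (simp add: hyper_system_def)
  qed
  with m show "\<exists>m\<ge>1. \<exists>c. \<forall>j<n. is_chain hyper hausdorff_dist (hyper_system f) e m (A j) (B j) (c j)"
    by (intro exI[of _ m] conjI exI[of _ "\<lambda>j t. level_set (c j t) 1"]) auto
qed

lemma hyper_mixing_imp_fuzzy_mixing:
  fixes f :: "nat \<Rightarrow> 'a::metric_space \<Rightarrow> 'a"
  assumes X: "compact (UNIV :: 'a set)" and f: "\<And>n. continuous_on UNIV (f n)"
    and equi: "equi_continuous f"
    and mix: "chain_weakly_mixing_all_orders (hyper :: 'a set set) hausdorff_dist (hyper_system f)"
  shows "chain_weakly_mixing_all_orders (fuzzy :: ('a \<Rightarrow> real) set) fuzzy_dist (fuzzy_system f)"
  unfolding chain_weakly_mixing_iff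
proof (intro allI impI)
  fix n :: nat and u v :: "nat \<Rightarrow> 'a \<Rightarrow> real" and e :: real
  assume n: "1 \<le> n" and uv: "\<forall>j<n. u j \<in> fuzzy \<and> v j \<in> fuzzy" and e: "0 < e"
  \<comment> \<open>Each step of the final chain makes three errors of at most \<eta>, in total
    \<open>3 * e / 4\<close>.\<close>
  define \<eta> where "\<eta> = e / 4"
  have \<eta>: "\<eta> > 0" using e by (simp add: \<eta>_def)
  \<comment> \<open>One \<delta> has to serve all times: the chain length \<open>m\<close> is known
    only after \<open>d\<close> and the levels \<open>L\<close> have been chosen.\<close>
  obtain \<delta> where \<delta>: "\<delta> > 0" "\<And>n x y. dist x y < \<delta> \<Longrightarrow> dist (f n x) (f n y) < \<eta>"
    using equi \<eta> unfolding equi_continuous_def by meson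
  define d where "d = min \<eta> (\<delta> / 2)"
  have d: "d > 0" "d \<le> \<eta>" "d < \<delta>" using \<eta> \<delta>(1) by (auto simp: d_def)
  have U: "finite (u ` {..<n} \<union> v ` {..<n})" "u ` {..<n} \<union> v ` {..<n} \<subseteq> fuzzy"
    using uv by auto
  obtain L where L: "finite L" "L \<subseteq> {0<..1}" "1 \<in> L"
    and close: "\<And>w \<alpha>. w \<in> u ` {..<n} \<union> v ` {..<n} \<Longrightarrow> \<alpha> > 0 \<Longrightarrow>
       hausdorff_close d (level_set w \<alpha>) (\<Union>l\<in>{l\<in>L. \<alpha> \<le> l}. level_set w l)"
    using fuzzy_finite_common_levels[OF X U d(1)] by blast
  have "finite ({..<n} \<times> L)" "{..<n} \<times> L \<noteq> {}" using L n by (auto simp: lessThan_empty_iff)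
  moreover have "level_set (u (fst i)) (snd i) \<in> hyper" "level_set (v (fst i)) (snd i) \<in> hyper"
    if "i \<in> {..<n} \<times> L" for i
    using that uv L(2) by (auto intro!: fuzzy_level_in_hyper)
  \<comment> \<open>Mixing of order \<open>n * card L\<close> chains the level sets of all
    coordinates at all levels in \<open>L\<close>, with a common length.\<close>
  ultimately obtain m A where m: "m \<ge> 1" and A: "\<And>i. i \<in> {..<n} \<times> L \<Longrightarrow>
      is_chain hyper hausdorff_dist (hyper_system f) \<eta> m
        (level_set (u (fst i)) (snd i)) (level_set (v (fst i)) (snd i)) (A i)"
    by (rule chain_weakly_mixing_finite[OF mix, of "{..<n} \<times> L"
        "\<lambda>i. level_set (u (fst i)) (snd i)" "\<lambda>i. level_set (v (fst i)) (snd i)" \<eta>])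
      (use \<eta> in auto)
  have A_hyper: "A (j, l) t \<in> hyper" if "j < n" "l \<in> L" "t \<le> m" for j l t
    using A[of "(j, l)"] that by (auto simp: is_chain_def)
  define w where "w j t = step_fun L (\<lambda>l. A (j, l) t)" for j t
  \<comment> \<open>At times 0 and \<open>m\<close> the step functions only approximate
    \<open>u j\<close> and \<open>v j\<close>, so the exact endpoints are put in their
    place.\<close>
  define c where "c j t = (if t = 0 then u j else if t = m then v j else w j t)" for j t
  define B where "B j t \<alpha> = (\<Union>l\<in>{l\<in>L. \<alpha> \<le> l}. A (j, l) t)" for j t \<alpha>
  have "is_chain fuzzy fuzzy_dist (fuzzy_system f) e m (u j) (v j) (c j)" if j: "j < n" for j
    unfolding is_chain_def
  proof (intro conjI allI impI)
    show "c j 0 = u j" "c j m = v j" using m by (auto simp: c_def)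
    show fz: "c j t \<in> fuzzy" if "t \<le> m" for t
      using uv j step_fun_fuzzy[OF X L, of "\<lambda>l. A (j, l) t"] A_hyper that
      by (auto simp: c_def w_def)
    \<comment> \<open>The error \<open>d\<close> is incurred only at the two ends; in between, the
      level sets equal \<open>B j t \<alpha>\<close>.\<close>
    have cB: "hausdorff_close d (level_set (c j t) \<alpha>) (B j t \<alpha>)"
      if t: "t \<le> m" and \<alpha>: "\<alpha> > 0" for t \<alpha>
    proof -
      consider "t = 0" | "t = m" "t \<noteq> 0" | "t \<noteq> 0" "t \<noteq> m" by blast
      then show ?thesis
      proof cases
        case 1
        then have "B j t \<alpha> = (\<Union>l\<in>{l\<in>L. \<alpha> \<le> l}. level_set (u j) l)"
          using A j by (force simp: B_def is_chain_def)
        then show ?thesis using 1 close[of "u j" \<alpha>] j \<alpha> by (simp add: c_def)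
      next
        case 2
        then have "B j t \<alpha> = (\<Union>l\<in>{l\<in>L. \<alpha> \<le> l}. level_set (v j) l)"
          using A j by (force simp: B_def is_chain_def)
        then show ?thesis using 2 close[of "v j" \<alpha>] j \<alpha> by (simp add: c_def)
      next
        case 3
        then have "level_set (c j t) \<alpha> = B j t \<alpha>"
          using level_set_step_fun[OF L(1) \<alpha>] by (simp add: c_def w_def B_def)
        then show ?thesis using d(1) by (simp add: hausdorff_close_refl)
      qed
    qed
    fix t assume t: "t < m"
    have lev: "level_set (fuzzy_system f t (c j t)) \<alpha> = f t ` level_set (c j t) \<alpha>"
      if "\<alpha> \<in> {0<..1}" for \<alpha>
      using level_set_fuzzy_system[of f t "c j t" \<alpha>] X f fz t that by simp
    have image_hyper: "f t ` C \<in> hyper" if "C \<in> hyper" for C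
      using that by (auto simp: hyper_def intro!: compact_continuous_image continuous_on_subset[OF f])
    \<comment> \<open>Three hops at each level \<alpha>: the image of the level set to
      \<open>f t\<close> applied to \<open>B j t \<alpha>\<close> by equi-continuity, on to
      \<open>B j (Suc t) \<alpha>\<close> by the chains \<open>A\<close>, and from there to the
      level set of \<open>c j (Suc t)\<close>.\<close>
    have "fuzzy_dist (fuzzy_system f t (c j t)) (c j (Suc t)) \<le> \<eta> + \<eta> + d"
    proof (rule fuzzy_dist_le)
      fix \<alpha> :: real assume \<alpha>: "\<alpha> \<in> {0<..1}"
      show "level_set (fuzzy_system f t (c j t)) \<alpha> \<in> hyper"
        using lev[OF \<alpha>] image_hyper fuzzy_level_in_hyper[OF fz \<alpha>] t by simp
      show "level_set (c j (Suc t)) \<alpha> \<in> hyper"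
        using fuzzy_level_in_hyper[OF fz \<alpha>] t by simp
      have "dist (f t x) (f t y) \<le> \<eta>" if "dist x y \<le> d" for x y
        using \<delta>(2)[of x y t] that d(3) by simp
      then have 1: "hausdorff_close \<eta> (f t ` level_set (c j t) \<alpha>) (f t ` B j t \<alpha>)"
        using cB[of t \<alpha>] t \<alpha> by (intro hausdorff_close_image[where d = d]) auto
      have "hausdorff_close \<eta> (f t ` A (j, l) t) (A (j, l) (Suc t))" if l: "l \<in> L" for l
      proof -
        have "hausdorff_dist (f t ` A (j, l) t) (A (j, l) (Suc t)) \<le> \<eta>"
          using A[of "(j, l)"] j l t by (fastforce simp: is_chain_def hyper_system_def)
        then show ?thesis
          using hausdorff_dist_le_iff image_hyper A_hyper j l t by (metis Suc_leI less_imp_le)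
      qed
      then have 2: "hausdorff_close \<eta> (f t ` B j t \<alpha>) (B j (Suc t) \<alpha>)"
        unfolding B_def image_UN by (intro hausdorff_close_UN) auto
      have 3: "hausdorff_close d (B j (Suc t) \<alpha>) (level_set (c j (Suc t)) \<alpha>)"
        using cB[of "Suc t" \<alpha>] t \<alpha> by (simp add: hausdorff_close_sym)
      show "hausdorff_close (\<eta> + \<eta> + d) (level_set (fuzzy_system f t (c j t)) \<alpha>)
          (level_set (c j (Suc t)) \<alpha>)"
        unfolding lev[OF \<alpha>] by (rule hausdorff_close_trans[OF hausdorff_close_trans[OF 1 2] 3])
    qed
    also have "\<dots> < e" using d(2) e by (simp add: \<eta>_def)
    finally show "fuzzy_dist (fuzzy_system f t (c j t)) (c j (Suc t)) < e" .
  qed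
  with m show "\<exists>m\<ge>1. \<exists>c. \<forall>j<n. is_chain fuzzy fuzzy_dist (fuzzy_system f) e m (u j) (v j) (c j)"
    by blast
qed

theorem theorem3p3:
  fixes f :: "nat \<Rightarrow> 'a::metric_space \<Rightarrow> 'a"
  assumes "compact (UNIV :: 'a set)"
    and "\<And>n. continuous_on UNIV (f n)"
    and "equi_continuous f"
  shows "chain_weakly_mixing_all_orders (hyper :: 'a set set) hausdorff_dist (hyper_system f) \<longleftrightarrow>
         chain_weakly_mixing_all_orders (fuzzy :: ('a \<Rightarrow> real) set) fuzzy_dist (fuzzy_system f)"
  using hyper_mixing_imp_fuzzy_mixing fuzzy_mixing_imp_hyper_mixing assms by blast

end
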